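(* Let $p$ be a prime, $n,m\ge 1$ integers, and $F:\mathbb{F}_{p^n}\to\mathbb{F}_{p^m}$ any function. For every $u\in\mathbb{F}_{p^n}$, $v\in\mathbb{F}_{p^m}$ and $j\in\mathbb{F}_p$, $$L_F(u,v;j)=\frac1p\sum_{t\in\mathbb{F}_p^*}\zeta_p^{-tj}\,\mathrm{AC}_F(u,tv).$$ Conversely, for every $u\in\mathbb{F}_{p^n}$, $v\in\mathbb{F}_{p^m}$ and $t\in\mathbb{F}_p^*$, $$\mathrm{AC}_F(u,tv)=\sum_{j\in\mathbb{F}_p}L_F(u,v;j)\,\zeta_p^{tj}.$$
   Context: $\zeta_p=e^{2\pi i/p}$; $\mathrm{Tr}_1^m(z)=z+z^p+\cdots+z^{p^{m-1}}$ is the absolute trace $\mathbb{F}_{p^m}\to\mathbb{F}_p$; $\mathbb{F}_p^*=\mathbb{F}_p\setminus\{0\}$. The derivative of $F$ in direction $u$ is $D_uF(x)=F(x+u)-F(x)$. The additive autocorrelation is $\mathrm{AC}_F(u,v)=\sum_{x\in\mathbb{F}_{p^n}}\zeta_p^{\mathrm{Tr}_1^m(vD_uF(x))}$. The level count is $N_F(u,v;j)=\#\{x\in\mathbb{F}_{p^n}:\mathrm{Tr}_1^m(vD_uF(x))=j\}$ and the centered level count is $L_F(u,v;j)=N_F(u,v;j)-p^{n-1}$. *)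

theory Defs
  imports "HOL-Analysis.Analysis" "HOL-Number_Theory.Number_Theory"
begin

(* A finite field of order q is any type of sort {field, finite} with CARD = q.
   F_p is realised as the prime subfield of the codomain F_(p^m): the image of the
   integers in it. *)

definition prime_subfield :: "'b::field set" where
  "prime_subfield = range of_int"

definition zeta :: "nat \<Rightarrow> complex" where
  "zeta p = exp (2 * of_real pi * \<i> / of_nat p)"

(* zeta_p^a for an exponent a in F_p: a is replaced by its least nonnegative integer
   representative. The lemma zeta_pow_of_int below shows that the choice of the
   representative is irrelevant. For a outside the prime subfield the value is
   unspecified. *)
definition zeta_pow :: "nat \<Rightarrow> 'b::field \<Rightarrow> complex" where
  "zeta_pow p a = zeta p ^ (LEAST k. of_nat k = a)"

definition abs_trace :: "nat \<Rightarrow> nat \<Rightarrow> 'b::field \<Rightarrow> 'b" where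
  "abs_trace p m z = (\<Sum>i<m. z ^ (p ^ i))"

definition derivative_in_dir :: "('a::field \<Rightarrow> 'b::field) \<Rightarrow> 'a \<Rightarrow> 'a \<Rightarrow> 'b" where
  "derivative_in_dir F u x = F (x + u) - F x"

definition autocorrelation ::
  "nat \<Rightarrow> nat \<Rightarrow> ('a::{field,finite} \<Rightarrow> 'b::{field,finite}) \<Rightarrow> 'a \<Rightarrow> 'b \<Rightarrow> complex" where
  "autocorrelation p m F u v =
     (\<Sum>x\<in>UNIV. zeta_pow p (abs_trace p m (v * derivative_in_dir F u x)))"

definition level_count ::
  "nat \<Rightarrow> nat \<Rightarrow> ('a::{field,finite} \<Rightarrow> 'b::{field,finite}) \<Rightarrow> 'a \<Rightarrow> 'b \<Rightarrow> 'b \<Rightarrow> nat" where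
  "level_count p m F u v j =
     card {x. abs_trace p m (v * derivative_in_dir F u x) = j}"

definition centered_level_count ::
  "nat \<Rightarrow> nat \<Rightarrow> nat \<Rightarrow> ('a::{field,finite} \<Rightarrow> 'b::{field,finite}) \<Rightarrow> 'a \<Rightarrow> 'b \<Rightarrow> 'b \<Rightarrow> int" where
  "centered_level_count p n m F u v j =
     int (level_count p m F u v j) - int p ^ (n - 1)"

lemma zeta_power_p: "p > 0 \<Longrightarrow> zeta p ^ p = 1"
  by (simp add: zeta_def flip: exp_of_nat_mult)

lemma zeta_powi_cong:
  assumes "p > 0" and "[k = l] (mod int p)"
  shows "zeta p powi k = zeta p powi l"
proof -
  obtain q where q: "k = l + int p * q"
    using assms(2) by (metis cong_iff_lin cong_sym)
  have "zeta p \<noteq> 0" by (simp add: zeta_def)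
  then show ?thesis
    using zeta_power_p[OF assms(1)] by (simp add: q power_int_add power_int_mult)
qed

lemma zeta_pow_of_int:
  assumes p: "prime p" and char: "CHAR('b::field) = p"
  shows "zeta_pow p (of_int k :: 'b) = zeta p powi k"
proof -
  have p0: "p > 0" using p by (simp add: prime_gt_0_nat)
  define l where "l = (LEAST l. of_nat l = (of_int k :: 'b))"
  have "of_nat (nat (k mod int p)) = (of_int k :: 'b)"
  proof -
    have "(of_int k :: 'b) = of_int (int p * (k div int p) + k mod int p)" by simp
    also have "\<dots> = of_nat p * of_int (k div int p) + of_int (k mod int p)"
      by (simp only: of_int_add of_int_mult of_int_of_nat_eq)
    also have "(of_nat p :: 'b) = 0" using of_nat_CHAR[where 'a='b] char by simp
    finally show ?thesis using p0 by (simp add: of_nat_nat)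
  qed
  then have "of_nat l = (of_int k :: 'b)" unfolding l_def by (rule LeastI)
  then have "of_int (int l - k) = (0::'b)" by simp
  then have "int p dvd int l - k" using char
    by (simp add: of_int_eq_0_iff_char_dvd del: of_int_diff)
  then have "[int l = k] (mod int p)" by (simp add: cong_iff_dvd_diff)
  from zeta_powi_cong[OF p0 this] show ?thesis
    by (simp add: zeta_pow_def l_def)
qed

end

theory Submission
  imports Defs
begin

text \<open>
  The trace takes values in \<open>\<bbbF>\<^sub>p\<close>, because it is fixed by the Frobenius map and \<open>\<bbbF>\<^sub>p\<close> already
  contains all \<open>p\<close> possible roots of \<open>X\<^sup>p - X\<close>; it is \<open>\<bbbF>\<^sub>p\<close>-linear by Fermat. Hence \<open>AC\<^sub>F(u, tv)\<close> is
  the sum of the character values \<open>\<zeta>\<^sub>p\<^sup>t\<^sup>j\<close> weighted by the level counts, and both identities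
  follow from the orthogonality of the additive characters of \<open>\<bbbF>\<^sub>p\<close>; the term \<open>t = 0\<close>
  accounts for the centering.
\<close>

lemma CHAR_eq_prime_of_CARD:
  assumes "prime p" and "CARD('b::{field,finite}) = p ^ m"
  shows "CHAR('b) = p"
proof -
  have "prime CHAR('b)"
    by (intro prime_CHAR_semidom finite_imp_CHAR_pos) simp
  moreover have "CHAR('b) dvd p ^ m"
    using CHAR_dvd_CARD[where 'a='b] assms(2) by simp
  ultimately show ?thesis
    using assms(1) by (meson prime_dvd_power primes_dvd_imp_eq)
qed

text \<open>The library states this fact for the class \<open>finite_field\<close>, of which
  \<open>{field,finite}\<close> is not a subsort.\<close>

lemma field_power_CARD: "(x::'b::{field,finite}) ^ CARD('b) = x"
proof (cases "x = 0")
  case False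
  \<comment> \<open>Multiplication by \<open>x\<close> permutes the nonzero elements, so their
    product can be cancelled, leaving \<open>x ^ (CARD('b) - 1) = 1\<close>.\<close>
  have "bij_betw ((*) x) (UNIV - {0}) (UNIV - {0})"
    by (rule bij_betw_byWitness[where f' = "\<lambda>y. y / x"]) (use False in auto)
  then have "(\<Prod>y\<in>UNIV - {0}. x * y) = \<Prod>(UNIV - {0})"
    by (rule prod.reindex_bij_betw)
  moreover have "\<Prod>(UNIV - {0::'b}) \<noteq> 0" by simp
  ultimately have "x ^ (CARD('b) - 1) = 1"
    by (simp add: prod.distrib card_Diff_singleton)
  then show ?thesis
    by (metis mult.right_neutral power_minus_mult zero_less_card_finite mult_1)
qed simp

lemma prime_subfield_closed:
  shows "0 \<in> prime_subfield" and "1 \<in> prime_subfield"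
    and "a \<in> prime_subfield \<Longrightarrow> - a \<in> prime_subfield"
    and "a \<in> prime_subfield \<Longrightarrow> b \<in> prime_subfield \<Longrightarrow> a + b \<in> prime_subfield"
    and "a \<in> prime_subfield \<Longrightarrow> b \<in> prime_subfield \<Longrightarrow> a - b \<in> prime_subfield"
    and "a \<in> prime_subfield \<Longrightarrow> b \<in> prime_subfield \<Longrightarrow> a * b \<in> prime_subfield"
  unfolding prime_subfield_def
  by (auto intro: range_eqI[of _ _ 0] range_eqI[of _ _ 1]
      simp flip: of_int_minus of_int_add of_int_diff of_int_mult)

text \<open>Reduction modulo \<open>p\<close> shows that the residues from 0 to p - 1 cover the
  image, and distinct residues are incongruent modulo the characteristic.\<close>

lemma card_prime_subfield:
  assumes "CHAR('b::field) = p" and "p > 0"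
  shows "card (prime_subfield :: 'b set) = p"
proof -
  have "(prime_subfield :: 'b set) = of_int ` {0..<int p}"
  proof -
    have "(of_int k :: 'b) = of_int (k mod int p)" for k
      using assms by (simp add: of_int_eq_iff_cong_CHAR)
    moreover have "k mod int p \<in> {0..<int p}" for k
      using assms by simp
    ultimately show ?thesis
      unfolding prime_subfield_def by blast
  qed
  moreover have "inj_on (of_int :: int \<Rightarrow> 'b) {0..<int p}"
    using assms by (auto simp: inj_on_def of_int_eq_iff_cong_CHAR cong_less_imp_eq_int)
  ultimately show ?thesis
    by (metis card_atLeastLessThan_int card_image diff_zero nat_int)
qed

text \<open>Fermat's little theorem: \<open>freshmans_dream\<close> carries the identity from
  \<open>k\<close> to \<open>k + 1\<close>, and every integer has a natural representative modulo
  \<open>p\<close>.\<close>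

lemma prime_subfield_power_eq:
  assumes "prime p" and "CHAR('b::field) = p" and "(t::'b) \<in> prime_subfield"
  shows "t ^ p = t"
proof -
  have nat: "(of_nat k :: 'b) ^ p = of_nat k" for k
    by (induction k) (use assms in \<open>auto simp: freshmans_dream power_0_left\<close>)
  obtain k where "t = of_int k"
    using assms(3) by (auto simp: prime_subfield_def)
  also have "\<dots> = of_int (k mod int p)"
    using assms by (simp add: of_int_eq_iff_cong_CHAR)
  also have "\<dots> = of_nat (nat (k mod int p))"
    using assms by (simp add: prime_gt_0_nat)
  finally show ?thesis using nat by simp
qed

lemma prime_subfield_eq_fixed_points:
  assumes "prime p" and "CHAR('b::field) = p"
  shows "(prime_subfield :: 'b set) = {z. z ^ p = z}"
proof -
  define f :: "'b poly" where "f = Polynomial.monom 1 p - Polynomial.monom 1 1"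
  have p: "p > 1" using assms(1) by (rule prime_gt_1_nat)
  \<comment> \<open>As \<open>p > 1\<close>, the linear term does not touch this
    coefficient.\<close>
  have "poly.coeff f p = 1" using p by (simp add: f_def)
  then have "f \<noteq> 0" by auto
  have "degree f \<le> p"
    unfolding f_def by (intro degree_diff_le degree_monom_le[THEN order_trans]) (use p in auto)
  have roots: "{z. poly f z = 0} = {z. z ^ p = z}"
    by (simp add: f_def poly_monom)
  show ?thesis
  proof (rule card_seteq)
    show "finite {z::'b. z ^ p = z}"
      using poly_roots_finite[OF \<open>f \<noteq> 0\<close>] by (simp add: roots)
    show "prime_subfield \<subseteq> {z::'b. z ^ p = z}"
      using prime_subfield_power_eq[OF assms] by blast
    show "card {z::'b. z ^ p = z} \<le> card (prime_subfield :: 'b set)"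
      using card_poly_roots_bound[OF \<open>f \<noteq> 0\<close>] \<open>degree f \<le> p\<close> card_prime_subfield[OF assms(2)] p
      by (simp add: roots)
  qed
qed

lemma abs_trace_in_prime_subfield:
  assumes "prime p" and "CARD('b::{field,finite}) = p ^ m"
  shows "abs_trace p m (z::'b) \<in> prime_subfield"
proof -
  note char = CHAR_eq_prime_of_CARD[OF assms]
  have "abs_trace p m z ^ p = (\<Sum>i<m. z ^ (p ^ Suc i))"
    unfolding abs_trace_def using assms(1) char
    by (simp add: freshmans_dream_sum mult.commute flip: power_mult)
  \<comment> \<open>Frobenius has shifted all exponents up by one. Adding \<open>z\<close> restores
    the term \<open>i = 0\<close>, and the extra top term \<open>z ^ (p ^ m)\<close> is again
    \<open>z\<close>.\<close>
  also have "\<dots> + z = (\<Sum>i<Suc m. z ^ (p ^ i))"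
    by (subst sum.lessThan_Suc_shift) simp
  also have "\<dots> = abs_trace p m z + z"
    using field_power_CARD[of z] by (simp add: abs_trace_def assms(2))
  finally have "abs_trace p m z ^ p = abs_trace p m z" by simp
  then show ?thesis
    unfolding prime_subfield_eq_fixed_points[OF assms(1) char] by (rule CollectI)
qed

lemma abs_trace_mult_prime_subfield:
  assumes "prime p" and "CHAR('b::field) = p" and "(t::'b) \<in> prime_subfield"
  shows "abs_trace p m (t * z) = t * abs_trace p m z"
proof -
  have "t ^ (p ^ i) = t" for i
    by (induction i) (simp_all add: power_mult prime_subfield_power_eq[OF assms])
  then show ?thesis
    by (simp add: abs_trace_def power_mult_distrib sum_distrib_left)
qed

text \<open>The value does not depend on the integer lift of the exponent, so the law for integer
  powers descends: \<open>zeta_pow p\<close> is an additive character of the prime subfield.\<close>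

lemma zeta_pow_add:
  assumes "prime p" and "CHAR('b::field) = p"
    and "(a::'b) \<in> prime_subfield" and "b \<in> prime_subfield"
  shows "zeta_pow p (a + b) = zeta_pow p a * zeta_pow p b"
proof -
  obtain k l where kl: "a = of_int k" "b = of_int l"
    using assms(3,4) by (auto simp: prime_subfield_def)
  have "zeta p \<noteq> 0" by (simp add: zeta_def)
  then show ?thesis
    using zeta_pow_of_int[OF assms(1,2)] by (simp add: kl power_int_add flip: of_int_add)
qed

lemma zeta_pow_0: "zeta_pow p 0 = 1"
  by (simp add: zeta_pow_def Least_eq_0)

text \<open>Nontriviality of the character: \<open>zeta p\<close> has exact order \<open>p\<close>,
  and \<open>of_nat k\<close> vanishes exactly when \<open>p\<close> divides
  \<open>k\<close>.\<close>

lemma zeta_pow_eq_1_iff: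
  assumes "prime p" and "CHAR('b::field) = p" and "(a::'b) \<in> prime_subfield"
  shows "zeta_pow p a = 1 \<longleftrightarrow> a = 0"
proof -
  define k where "k = (LEAST k. of_nat k = a)"
  have p: "p \<ge> 1" using assms(1) prime_ge_1_nat by blast
  obtain i where i: "a = of_int i"
    using assms(3) by (auto simp: prime_subfield_def)
  \<comment> \<open>Some natural number represents \<open>a\<close>, so the least one
    exists.\<close>
  have "of_nat (nat (i mod int p)) = (of_int (i mod int p) :: 'b)"
    using p by simp
  also have "\<dots> = a"
    using assms(2) by (simp add: i of_int_eq_iff_cong_CHAR)
  finally have k: "of_nat k = a"
    unfolding k_def by (rule LeastI)
  have "zeta_pow p a = exp (2 * of_real pi * \<i> * of_nat k / of_nat p)"
    by (simp add: zeta_pow_def zeta_def mult_ac flip: k_def exp_of_nat_mult)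
  then have "zeta_pow p a = 1 \<longleftrightarrow> p dvd k"
    using complex_root_unity_eq_1[OF p] by simp
  then show ?thesis
    using k assms(2) by (metis of_nat_eq_0_iff_char_dvd)
qed

text \<open>For \<open>a \<noteq> 0\<close>, the shift of \<open>t\<close> by 1 permutes the index
  set yet multiplies the sum by \<open>zeta_pow p a\<close>, which is not 1; hence the sum is
  0.\<close>

lemma sum_zeta_pow_mult:
  assumes "prime p" and "CHAR('b::field) = p" and "(a::'b) \<in> prime_subfield"
  shows "(\<Sum>t\<in>prime_subfield. zeta_pow p (t * a)) = (if a = 0 then of_nat p else 0)"
proof (cases "a = 0")
  case True
  then show ?thesis
    using card_prime_subfield[OF assms(2)] assms(1) by (simp add: zeta_pow_0 prime_gt_0_nat)
next
  case False
  let ?S = "\<Sum>t\<in>prime_subfield. zeta_pow p (t * a)"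
  have "bij_betw (\<lambda>t. t + 1 :: 'b) prime_subfield prime_subfield"
    by (rule bij_betw_byWitness[where f' = "\<lambda>t. t - 1"]) (auto intro: prime_subfield_closed)
  then have "?S = (\<Sum>t\<in>prime_subfield. zeta_pow p ((t + 1) * a))"
    by (rule sum.reindex_bij_betw[symmetric])
  also have "\<dots> = (\<Sum>t\<in>prime_subfield. zeta_pow p (t * a) * zeta_pow p a)"
    using assms by (intro sum.cong) (simp_all add: distrib_right zeta_pow_add prime_subfield_closed)
  also have "\<dots> = ?S * zeta_pow p a"
    by (simp add: sum_distrib_right)
  finally show ?thesis
    using zeta_pow_eq_1_iff[OF assms] False by simp
qed

theorem proposition3p3:
  fixes p n m :: nat
    and F :: "'a::{field,finite} \<Rightarrow> 'b::{field,finite}"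
  assumes "prime p" and "n \<ge> 1" and "m \<ge> 1"
    and "CARD('a) = p ^ n" and "CARD('b) = p ^ m"
  shows "(\<forall>u. \<forall>v. \<forall>j\<in>prime_subfield.
            of_int (centered_level_count p n m F u v j) =
              1 / of_nat p *
              (\<Sum>t\<in>prime_subfield - {0}. zeta_pow p (- (t * j)) * autocorrelation p m F u (t * v)))
       \<and> (\<forall>u. \<forall>v. \<forall>t\<in>prime_subfield - {0}.
            autocorrelation p m F u (t * v) =
              (\<Sum>j\<in>prime_subfield. of_int (centered_level_count p n m F u v j) * zeta_pow p (t * j)))"
proof -
  note p = \<open>prime p\<close>
  note char = CHAR_eq_prime_of_CARD[OF p \<open>CARD('b) = p ^ m\<close>]
  note [simp] = prime_subfield_closed
  let ?P = "prime_subfield :: 'b set"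
  define T where "T u v x = abs_trace p m (v * derivative_in_dir F u x)" for u v x
  have p0: "p > 0" using p by (rule prime_gt_0_nat)
  have T: "T u v x \<in> ?P" for u v x
    unfolding T_def by (rule abs_trace_in_prime_subfield[OF p \<open>CARD('b) = p ^ m\<close>])
  have AC: "autocorrelation p m F u (t * v) = (\<Sum>x\<in>UNIV. zeta_pow p (t * T u v x))"
    if "t \<in> ?P" for u v t
    by (simp add: autocorrelation_def T_def mult.assoc
        abs_trace_mult_prime_subfield[OF p char that])
  have N: "of_nat (level_count p m F u v j) = (\<Sum>x\<in>UNIV. if T u v x = j then 1 else 0 :: complex)"
    for u v j
    by (simp add: level_count_def T_def flip: sum.inter_filter)
  \<comment> \<open>\<open>n \<ge> 1\<close> matters here because \<open>n - 1\<close> is truncated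
    subtraction.\<close>
  have pn: "of_nat p * of_nat p ^ (n - 1) = (of_nat CARD('a) :: complex)"
    using \<open>n \<ge> 1\<close> \<open>CARD('a) = p ^ n\<close> by (cases n) simp_all
  have fwd: "of_int (centered_level_count p n m F u v j) = 1 / of_nat p *
      (\<Sum>t\<in>?P - {0}. zeta_pow p (- (t * j)) * autocorrelation p m F u (t * v))"
    if j: "j \<in> ?P" for u v j
  proof -
    have "(\<Sum>t\<in>?P - {0}. zeta_pow p (- (t * j)) * autocorrelation p m F u (t * v))
        = (\<Sum>t\<in>?P - {0}. \<Sum>x\<in>UNIV. zeta_pow p (t * (T u v x - j)))"
    proof (rule sum.cong[OF refl])
      fix t assume "t \<in> ?P - {0}"
      then show "zeta_pow p (- (t * j)) * autocorrelation p m F u (t * v)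
          = (\<Sum>x\<in>UNIV. zeta_pow p (t * (T u v x - j)))"
        using j T by (simp add: AC sum_distrib_left algebra_simps
            flip: zeta_pow_add[OF p char])
    qed
    also have "\<dots> = (\<Sum>x\<in>UNIV. \<Sum>t\<in>?P - {0}. zeta_pow p (t * (T u v x - j)))"
      by (rule sum.swap)
    \<comment> \<open>Orthogonality evaluates the sum over all \<open>t\<close>; the omitted term
      \<open>t = 0\<close> is 1. Summed over \<open>x\<close>, these ones give
      \<open>CARD('a)\<close>, which is \<open>p\<close> times the centering constant.\<close>
    also have "\<dots> = (\<Sum>x\<in>UNIV. of_nat p * (if T u v x = j then 1 else 0) - 1)"
      using j T by (intro sum.cong)
        (simp_all add: sum_diff1 sum_zeta_pow_mult[OF p char] zeta_pow_0)
    also have "\<dots> = of_nat p * of_nat (level_count p m F u v j) - of_nat CARD('a)"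
      by (simp add: N sum_subtractf sum_distrib_left)
    also have "\<dots> = of_nat p * of_int (centered_level_count p n m F u v j)"
      by (simp add: centered_level_count_def right_diff_distrib flip: pn)
    finally show ?thesis using p0 by simp
  qed
  have bwd: "autocorrelation p m F u (t * v) =
      (\<Sum>j\<in>?P. of_int (centered_level_count p n m F u v j) * zeta_pow p (t * j))"
    if t: "t \<in> ?P - {0}" for u v t
  proof -
    have "(\<Sum>j\<in>?P. of_int (centered_level_count p n m F u v j) * zeta_pow p (t * j))
        = (\<Sum>j\<in>?P. of_nat (level_count p m F u v j) * zeta_pow p (t * j))
          - of_nat p ^ (n - 1) * (\<Sum>j\<in>?P. zeta_pow p (j * t))"
      by (simp add: centered_level_count_def left_diff_distrib sum_subtractf sum_distrib_left
          mult.commute[of t])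
    \<comment> \<open>Orthogonality with \<open>t \<noteq> 0\<close> makes the centering constant
      drop out.\<close>
    also have "(\<Sum>j\<in>?P. zeta_pow p (j * t)) = 0"
      using t by (simp add: sum_zeta_pow_mult[OF p char])
    also have "(\<Sum>j\<in>?P. of_nat (level_count p m F u v j) * zeta_pow p (t * j))
        = (\<Sum>j\<in>?P. \<Sum>x\<in>UNIV. if T u v x = j then zeta_pow p (t * j) else 0)"
      by (intro sum.cong refl) (auto simp: N sum_distrib_right intro!: sum.cong)
    also have "\<dots> = (\<Sum>x\<in>UNIV. \<Sum>j\<in>?P. if T u v x = j then zeta_pow p (t * j) else 0)"
      by (rule sum.swap)
    \<comment> \<open>Each \<open>x\<close> contributes exactly one term, since its trace value lies
      in \<open>?P\<close>.\<close>
    also have "\<dots> = (\<Sum>x\<in>UNIV. zeta_pow p (t * T u v x))"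
      using T by simp
    finally show ?thesis using t by (simp add: AC)
  qed
  show ?thesis using fwd bwd by blast
qed

end
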